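(* Let $X$ be a hyperelliptic curve of genus $g$ over a field $F$ with $\mathrm{char}(F)\ne2$, with affine model $y^2=f(x)$, $\deg f=2g+1$. Assume that $\ell>g$, let $$\lambda:=(1,y,\dots,x^{\ell-g-1},x^{\ell-g-1}y;\,x^{\ell-g},x^{\ell-g+1},\dots,x^\ell)$$ denote the monomial basis of the complete linear series $|\mathcal{O}_X(2\ell\infty_X)|$, and assume that $\det M(\ell,g)$ is nonzero in $F$. With respect to the local étale coordinate $y$, the lowest-order term of the Hasse Wronskian $w(\lambda)$ in a ramification point $(\gamma,0)\in R_\pi\setminus\{\infty_X\}$ is that of $$\det M(\ell,g)\cdot(D^1_yx)^{\binom{g+1}2}(D^2_yx)^{\ell(\ell-g)}.$$
   Context: $X$ is smooth and projective, $\pi:X\to\mathbb{P}^1$ is $(x,y)\mapsto x$, $\infty_X=\pi^{-1}(\infty)$, and $R_\pi$ is the ramification divisor, consisting of $\infty_X$ and the points $(\gamma,0)$ with $f(\gamma)=0$. $M(\ell,g)$ is the $(g+1)\times(g+1)$ matrix with entries $M_{ij}=\binom{\ell-g+j}{2j-i}$, $0\le i,j\le g$, where a binomial coefficient with negative lower index, or lower index exceeding the upper one, is $0$. Hasse derivatives: near $(\gamma,0)$ the function $y$ is an étale coordinate, and $D^k_y$ ($k\ge0$), acting on local functions, are the unique $F$-linear maps with $D^0_y=\mathrm{id}$, $D^k_y(\phi\psi)=\sum_{i=0}^kD^i_y\phi\,D^{k-i}_y\psi$ and $D^k_yy^n=\binom nky^{n-k}$. The basis $\lambda=(\lambda_0,\dots,\lambda_r)$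 alternates $x^i,x^iy$ for $0\le i\le\ell-g-1$ and then lists $x^{\ell-g},\dots,x^\ell$; $r+1=2\ell-g+1$. With respect to the coordinate $y$ (and the generator $1$ of $\mathcal{O}_X(2\ell\infty_X)$ on $X\setminus\{\infty_X\}$), the Hasse Wronskian is $w(\lambda)=\det(D^i_y\lambda_j)_{0\le i,j\le r}$. The lowest-order term of a function at $(\gamma,0)$ is the nonzero term of lowest degree of its expansion in the completed local ring $k(\gamma)[[y]]$, $k(\gamma)=F(\gamma)$. *)

theory Defs
  imports
    "HOL-Algebra.Algebraic_Closure_Type"
    "HOL-Computational_Algebra.Formal_Power_Series"
    "Jordan_Normal_Form.Determinant"
begin

text \<open>
  The smooth projective curve \<open>X\<close> is given through its function field \<open>'L\<close> over the ground
  field \<open>F = 'a\<close>, together with the coordinate functions \<open>x\<close> and \<open>y\<close>: \<open>x\<close> is transcendental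
  over \<open>F\<close>, \<open>y\<^sup>2 = f(x)\<close>, and \<open>'L\<close> is spanned by \<open>1\<close> and \<open>y\<close> over the field of rational
  functions in \<open>x\<close>. Since \<open>f\<close> has odd degree it is not a square, so these conditions
  determine \<open>('L, x, y)\<close> up to unique isomorphism. Smoothness is the Jacobian criterion for
  \<open>y\<^sup>2 - f(x)\<close> at all geometric points of the affine model; the smooth projective model has
  the one further point \<open>\<infinity>\<^sub>X\<close>.
\<close>

locale hyperelliptic_curve = base: field_hom \<iota>
  for \<iota> :: "'a::field \<Rightarrow> 'L::field" +
  fixes f :: "'a poly" and g :: nat and x y :: 'L
  assumes char_ne_2: "CHAR('a) \<noteq> 2"
    and degree_f: "degree f = 2 * g + 1"
    and smooth: "\<And>a b :: 'a alg_closure. b\<^sup>2 = poly (map_poly to_ac f) a \<Longrightarrow>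
          \<not> (2 * b = 0 \<and> poly (pderiv (map_poly to_ac f)) a = 0)"
    and x_transcendental: "\<And>p :: 'a poly. p \<noteq> 0 \<Longrightarrow> poly (map_poly \<iota> p) x \<noteq> 0"
    and curve_equation: "y\<^sup>2 = poly (map_poly \<iota> f) x"
    and generated: "\<And>h. \<exists>a b c. c \<noteq> 0 \<and>
          h = (poly (map_poly \<iota> a) x + poly (map_poly \<iota> b) x * y) / poly (map_poly \<iota> c) x"

text \<open>
  A point \<open>(\<gamma>, 0)\<close> of the affine model with \<open>f(\<gamma>) = 0\<close>, with residue field
  \<open>'k = F(\<gamma>)\<close>. As \<open>\<gamma>\<close> is algebraic over \<open>F\<close>, \<open>F(\<gamma>) = F[\<gamma>]\<close>.
\<close>

locale affine_ramification_point = hyperelliptic_curve \<iota> f g x y + residue: field_hom \<kappa>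
  for \<iota> :: "'a::field \<Rightarrow> 'L::field" and f :: "'a poly" and g :: nat and x y :: 'L
    and \<kappa> :: "'a \<Rightarrow> 'k::field" +
  fixes \<gamma> :: 'k
  assumes root: "poly (map_poly \<kappa> f) \<gamma> = 0"
    and residue_field: "\<And>c. \<exists>p. c = poly (map_poly \<kappa> p) \<gamma>"
begin

text \<open>
  The local ring at \<open>(\<gamma>, 0)\<close>: quotients of elements \<open>a(x) + b(x) y\<close> of the affine coordinate
  ring whose denominator \<open>c(x) + d(x) y\<close> has a nonzero value, namely \<open>c(\<gamma>)\<close>, at \<open>(\<gamma>, 0)\<close>.
\<close>

definition local_ring :: "'L set" where
  "local_ring =
     {(poly (map_poly \<iota> a) x + poly (map_poly \<iota> b) x * y) /
      (poly (map_poly \<iota> c) x + poly (map_poly \<iota> d) x * y) | a b c d.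
        poly (map_poly \<kappa> c) \<gamma> \<noteq> 0}"

text \<open>
  The characterisation of the Hasse derivatives \<open>D k = D\<^sup>k\<^sub>y\<close> on local functions; values of
  \<open>D k\<close> outside the local ring are irrelevant. Since \<open>y\<close> is an etale coordinate at
  \<open>(\<gamma>, 0)\<close>, there is exactly one such family on the local ring.
\<close>

definition hasse_derivatives :: "(nat \<Rightarrow> 'L \<Rightarrow> 'L) \<Rightarrow> bool" where
  "hasse_derivatives D \<longleftrightarrow>
     (\<forall>k. \<forall>\<phi>\<in>local_ring. D k \<phi> \<in> local_ring) \<and>
     (\<forall>k. \<forall>\<phi>\<in>local_ring. \<forall>\<psi>\<in>local_ring. D k (\<phi> + \<psi>) = D k \<phi> + D k \<psi>) \<and>
     (\<forall>k c. \<forall>\<phi>\<in>local_ring. D k (\<iota> c * \<phi>) = \<iota> c * D k \<phi>) \<and>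
     (\<forall>\<phi>\<in>local_ring. D 0 \<phi> = \<phi>) \<and>
     (\<forall>k. \<forall>\<phi>\<in>local_ring. \<forall>\<psi>\<in>local_ring.
        D k (\<phi> * \<psi>) = (\<Sum>i\<le>k. D i \<phi> * D (k - i) \<psi>)) \<and>
     (\<forall>k n. D k (y ^ n) = of_nat (n choose k) * y ^ (n - k))"

text \<open>
  The expansion of local functions in the completed local ring, identified with \<open>'k[[y]]\<close>:
  the homomorphism of \<open>F\<close>-algebras that sends \<open>y\<close> to the variable and \<open>x\<close> to a series
  with constant term \<open>x(\<gamma>, 0) = \<gamma>\<close>. As \<open>f'(\<gamma>) \<noteq> 0\<close>, the equation \<open>y\<^sup>2 = f(x)\<close> determines
  the series of \<open>x\<close> (Hensel), so there is exactly one such map on the local ring.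
\<close>

definition expansion :: "('L \<Rightarrow> 'k fps) \<Rightarrow> bool" where
  "expansion e \<longleftrightarrow>
     (\<forall>\<phi>\<in>local_ring. \<forall>\<psi>\<in>local_ring. e (\<phi> + \<psi>) = e \<phi> + e \<psi>) \<and>
     (\<forall>\<phi>\<in>local_ring. \<forall>\<psi>\<in>local_ring. e (\<phi> * \<psi>) = e \<phi> * e \<psi>) \<and>
     (\<forall>c. e (\<iota> c) = fps_const (\<kappa> c)) \<and>
     e y = fps_X \<and>
     fps_nth (e x) 0 = \<gamma>"

end

text \<open>
  The basis \<open>1, y, \<dots>, x^(l-g-1), x^(l-g-1) y, x^(l-g), \<dots>, x^l\<close>. Sections of
  \<open>\<O>\<^sub>X(2l\<infinity>\<^sub>X)\<close> are written as functions by means of the generator \<open>1\<close> away from \<open>\<infinity>\<^sub>X\<close>.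
\<close>

definition monomial_basis :: "nat \<Rightarrow> nat \<Rightarrow> 'L::field \<Rightarrow> 'L \<Rightarrow> 'L list" where
  "monomial_basis l g x y =
     concat (map (\<lambda>i. [x ^ i, x ^ i * y]) [0..<l - g]) @ map (\<lambda>i. x ^ i) [l - g..<l + 1]"

definition hasse_wronskian :: "(nat \<Rightarrow> 'L \<Rightarrow> 'L) \<Rightarrow> 'L::field list \<Rightarrow> 'L" where
  "hasse_wronskian D bs =
     det (mat (length bs) (length bs) (\<lambda>(i, j). D i (bs ! j)))"

text \<open>The case distinction is needed because subtraction of natural numbers truncates.\<close>

definition M_matrix :: "nat \<Rightarrow> nat \<Rightarrow> int mat" where
  "M_matrix l g = mat (g + 1) (g + 1)
     (\<lambda>(i, j). if i \<le> 2 * j then int ((l - g + j) choose (2 * j - i)) else 0)"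

text \<open>Meaningful for nonzero series; by the convention \<open>subdegree 0 = 0\<close>, the value at \<open>0\<close> is \<open>0\<close>.\<close>

definition lowest_order_term :: "'k::field fps \<Rightarrow> 'k fps" where
  "lowest_order_term \<phi> = fps_const (fps_nth \<phi> (subdegree \<phi>)) * fps_X ^ subdegree \<phi>"

end

theory Submission
  imports Defs "Jordan_Normal_Form.Char_Poly"
begin

text \<open>
  The expansion \<open>\<phi>(y + z) = \<Sum>\<^sub>k D\<^sup>k\<phi> z\<^sup>k\<close> is a ring homomorphism from the local ring to \<open>k[[y]][[z]]\<close>
  that sends \<open>y\<close> to \<open>y + z\<close>. Since \<open>f(x) = y\<^sup>2\<close> and \<open>f'(\<gamma>) \<noteq> 0\<close>, it sends \<open>x - \<gamma>\<close> to \<open>(y + z)\<^sup>2 U\<close> with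
  \<open>U(0, 0) = c = 1 / f'(\<gamma>)\<close>. So \<open>(x - \<gamma>)\<^sup>n y\<^sup>\<epsilon>\<close> behaves to lowest order like \<open>c\<^sup>n y\<^bsup>2n + \<epsilon>\<^esup>\<close>, and the
  Wronskian, which does not change when \<open>x\<close> is replaced by \<open>x - \<gamma>\<close>, has as its leading coefficient a
  power of \<open>c\<close> times the determinant of the binomial coefficients of the exponents. After splitting off
  a unitriangular block, the latter is the determinant of the \<open>binomial(2(m + j), 2m + i)\<close> with \<open>m = l - g\<close>.
  Expanding \<open>(1 + z)\<^bsup>2N\<^esup> = (1 + z(2 + z))\<^sup>N\<close> factors this matrix into \<open>M(l, g)\<close>, with rows and columns scaled
  by powers of 2, and a unitriangular matrix.
\<close>

no_notation vec_index (infixl "$" 100)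

section \<open>Determinants of binomial coefficients\<close>

text \<open>In the Leibniz sum every permutation meets each row and each column exactly once, so
  every product contains all factors \<open>r i\<close> and, after reindexing by the permutation,
  all factors \<open>s j\<close>.\<close>

lemma det_scale:
  fixes A :: "nat \<Rightarrow> nat \<Rightarrow> 'a::comm_ring_1"
  shows "det (mat n n (\<lambda>(i, j). r i * A i j * s j)) =
    (\<Prod>i<n. r i) * (\<Prod>j<n. s j) * det (mat n n (\<lambda>(i, j). A i j))"
proof -
  have "(\<Prod>i = 0..<n. r i * A i (p i) * s (p i)) =
      (\<Prod>i<n. r i) * (\<Prod>j<n. s j) * (\<Prod>i = 0..<n. A i (p i))" if p: "p permutes {0..<n}" for p
    using prod.permute[OF p, of s] by (simp add: prod.distrib mult_ac o_def atLeast0LessThan)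
  moreover have "(\<Prod>i = 0..<n. mat n n (\<lambda>(i, j). B i j) $$ (i, p i)) = (\<Prod>i = 0..<n. B i (p i))"
    if "p permutes {0..<n}" for p and B :: "nat \<Rightarrow> nat \<Rightarrow> 'a"
    using permutes_in_image[OF that] by (intro prod.cong) auto
  ultimately show ?thesis
    by (simp add: det_def sum_distrib_left mult_ac cong: conj_cong)
qed

lemma det_unitriangular:
  fixes A :: "nat \<Rightarrow> nat \<Rightarrow> 'a::comm_ring_1"
  assumes "\<And>i j. j < i \<Longrightarrow> i < n \<Longrightarrow> A i j = 0" and "\<And>i. i < n \<Longrightarrow> A i i = 1"
  shows "det (mat n n (\<lambda>(i, j). A i j)) = 1"
proof -
  have "det (mat n n (\<lambda>(i, j). A i j)) = (\<Prod>i = 0..<n. A i i)"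
    by (subst det_upper_triangular[of _ n])
      (use assms(1) in \<open>auto simp: prod_list_diag_prod intro!: upper_triangularI\<close>)
  also have "\<dots> = 1"
    using assms(2) by simp
  finally show ?thesis .
qed

lemma mat_mult_entries:
  fixes A B :: "nat \<Rightarrow> nat \<Rightarrow> 'a::comm_semiring_0"
  shows "mat n n (\<lambda>(i, j). A i j) * mat n n (\<lambda>(i, j). B i j) =
    mat n n (\<lambda>(i, j). \<Sum>k<n. A i k * B k j)"
  by (intro eq_matI) (auto simp: scalar_prod_def atLeast0LessThan)

text \<open>Compare coefficients of \<open>z^q\<close> in
  \<open>(1 + z)^(2n) = (1 + z(2 + z))^n\<close>; the summand for \<open>k\<close> comes from
  \<open>z^k (2 + z)^k\<close>. Where \<open>2 * k - q\<close> truncates,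
  \<open>k choose (q - k)\<close> vanishes.\<close>

lemma choose_double_eq_sum:
  "int (2 * n choose q) =
    (\<Sum>k\<le>n. int (n choose k) * (if k \<le> q then int (k choose (q - k)) * 2 ^ (2 * k - q) else 0))"
proof -
  have "([:1, 1:] :: int poly) ^ (2 * n) = ([:0, 1:] * [:2, 1:] + 1) ^ n"
    by (simp add: power_mult power2_eq_square one_pCons)
  also have "\<dots> = (\<Sum>k\<le>n. of_nat (n choose k) * (monom 1 k * [:2, 1:] ^ k))"
    by (subst binomial_ring)
      (simp only: power_mult_distrib monom_altdef smult_1_left power_one mult_1_left mult_1_right mult_ac)
  finally have eq: "coeff ([:1, 1:] ^ (2 * n)) q =
      (\<Sum>k\<le>n. int (n choose k) * coeff (monom 1 k * [:2, 1:] ^ k) q)"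
    by (simp add: coeff_sum of_nat_poly)
  have lin: "coeff ([:a, 1:] ^ k) i = int (k choose i) * a ^ (k - i)" for a :: int and k i
  proof (cases "i \<le> k")
    case False
    have "degree ([:a, 1:] ^ k) \<le> k"
      using degree_power_le[of "[:a, 1:]" k] by simp
    then show ?thesis
      using False by (simp add: coeff_eq_0 binomial_eq_0)
  qed (simp add: coeff_linear_poly_power)
  have "coeff (monom 1 k * [:2, 1:] ^ k) q =
      (if k \<le> q then int (k choose (q - k)) * 2 ^ (2 * k - q) else 0)" for k
    by (cases "q \<le> 2 * k") (auto simp: coeff_monom_mult lin mult_2)
  with eq show ?thesis
    by (simp add: lin)
qed

text \<open>After the shift of the summation index by \<open>m\<close>, the lower index
  \<open>m + i - k\<close> turns by symmetry into the index \<open>2k - i\<close> of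
  \<open>M(l, g)\<close>, and the row factor \<open>2^i\<close> completes \<open>2^(2k - i)\<close>
  to the pure column factor \<open>4^k\<close>.\<close>

lemma choose_eq_sum_M_matrix:
  assumes "i \<le> g" "j \<le> g"
  shows "2 ^ i * int (2 * (m + j) choose (2 * m + i)) =
    (\<Sum>k<g + 1. 4 ^ k * M_matrix (m + g) g $$ (i, k) * int (m + j choose (m + k)))"
proof -
  let ?t = "\<lambda>k. int (m + j choose k) *
    (if k \<le> 2 * m + i then int (k choose (2 * m + i - k)) * 2 ^ (2 * k - (2 * m + i)) else 0)"
  have "int (2 * (m + j) choose (2 * m + i)) = (\<Sum>k\<le>m + j. ?t k)"
    by (rule choose_double_eq_sum)
  also have "\<dots> = (\<Sum>k\<in>{m..<m + (g + 1)}. ?t k)"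
    \<comment> \<open>Below \<open>m\<close> the factor \<open>k choose (2m + i - k)\<close> is zero
      since \<open>2k < 2m + i\<close>; above \<open>m + j\<close> the factor
      \<open>m + j choose k\<close> is zero.\<close>
    by (rule sum.mono_neutral_cong) (use assms in \<open>auto simp: binomial_eq_0\<close>)
  also have "\<dots> = (\<Sum>k<g + 1. ?t (m + k))"
    by (subst sum.atLeastLessThan_shift_0) (simp only: o_def atLeast0LessThan add_diff_cancel_left')
  finally have "2 ^ i * int (2 * (m + j) choose (2 * m + i)) = (\<Sum>k<g + 1. 2 ^ i * ?t (m + k))"
    by (simp only: sum_distrib_left)
  also have "\<dots> = (\<Sum>k<g + 1. 4 ^ k * M_matrix (m + g) g $$ (i, k) * int (m + j choose (m + k)))"
  proof (rule sum.cong[OF refl])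
    fix k assume "k \<in> {..<g + 1}"
    then have k: "k \<le> g" by auto
    \<comment> \<open>In the two outer cases both sides vanish; only in the middle one is no
      subtraction truncated.\<close>
    consider "2 * k < i" | "i \<le> 2 * k" "k \<le> m + i" | "k > m + i" by linarith
    then show "2 ^ i * ?t (m + k) =
      4 ^ k * M_matrix (m + g) g $$ (i, k) * int (m + j choose (m + k))"
    proof cases
      case 1
      then show ?thesis using k assms by (auto simp: M_matrix_def binomial_eq_0)
    next
      case 2
      have "(m + k choose (m + i - k)) = (m + k choose (2 * k - i))"
        using 2 by (subst binomial_symmetric) (auto intro!: arg_cong2[where f = binomial])
      moreover have "(2::int) ^ i * 2 ^ (2 * k - i) = 4 ^ k"
        using 2 power_mult[of "2::int" 2 k] by (simp flip: power_add)
      ultimately show ?thesis using k assms 2 by (simp add: M_matrix_def algebra_simps)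
    next
      case 3
      then show ?thesis using k assms by (auto simp: M_matrix_def binomial_eq_0)
    qed
  qed
  finally show ?thesis .
qed

lemma sum_less_Suc_eq_choose: "(\<Sum>i<n + 1. i) = (n + 1) choose 2"
  by (induction n) (auto simp: numeral_2_eq_2)

text \<open>Rows scaled by \<open>2^i\<close> give \<open>2^B\<close> on the left, columns scaled by
  \<open>4^k\<close> give \<open>4^B\<close> on the right, where \<open>B = 0 + ... + g\<close>, and
  the last factor is unitriangular. Cancelling \<open>2^B\<close> over the integers leaves
  \<open>2^B\<close>.\<close>

lemma det_choose_double:
  "det (mat (g + 1) (g + 1) (\<lambda>(i, j). int (2 * (m + j) choose (2 * m + i)))) =
    2 ^ ((g + 1) choose 2) * det (M_matrix (m + g) g)"
proof -
  let ?n = "g + 1" and ?B = "(g + 1) choose 2"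
  let ?A = "\<lambda>i j. int (2 * (m + j) choose (2 * m + i))"
  let ?M = "\<lambda>i j. M_matrix (m + g) g $$ (i, j)"
  \<comment> \<open>The factors \<open>1\<close> give both sides the shape row factor, entry, column
    factor of \<open>det_scale\<close>.\<close>
  have entry: "2 ^ i * ?A i j * 1 = (\<Sum>k<?n. 1 * ?M i k * 4 ^ k * int (m + j choose (m + k)))"
    if "i < ?n" "j < ?n" for i j
    using choose_eq_sum_M_matrix[of i g j m] that by (simp add: mult_ac del: sum.lessThan_Suc)
  have "2 ^ ?B * det (mat ?n ?n (\<lambda>(i, j). ?A i j)) =
      det (mat ?n ?n (\<lambda>(i, j). 2 ^ i * ?A i j * 1))"
    by (subst det_scale) (simp add: power_sum[symmetric] sum_less_Suc_eq_choose[simplified])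
  also have "mat ?n ?n (\<lambda>(i, j). 2 ^ i * ?A i j * 1) =
      mat ?n ?n (\<lambda>(i, j). 1 * ?M i j * 4 ^ j) * mat ?n ?n (\<lambda>(k, j). int (m + j choose (m + k)))"
    unfolding mat_mult_entries
    by (rule cong_mat) (simp_all only: prod.case entry)
  also have "det \<dots> = det (mat ?n ?n (\<lambda>(i, j). 1 * ?M i j * 4 ^ j)) *
      det (mat ?n ?n (\<lambda>(k, j). int (m + j choose (m + k))))"
    by (rule det_mult) auto
  also have "det (mat ?n ?n (\<lambda>(k, j). int (m + j choose (m + k)))) = 1"
    by (rule det_unitriangular) auto
  also have "det (mat ?n ?n (\<lambda>(i, j). 1 * ?M i j * 4 ^ j)) = 4 ^ ?B * det (mat ?n ?n (\<lambda>(i, j). ?M i j))"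
    by (subst det_scale) (simp add: power_sum[symmetric] sum_less_Suc_eq_choose[simplified])
  also have "mat ?n ?n (\<lambda>(i, j). ?M i j) = M_matrix (m + g) g"
    by (intro eq_matI) (auto simp: M_matrix_def)
  also have "(4::int) ^ ?B = 2 ^ ?B * 2 ^ ?B"
    by (simp flip: power_mult_distrib)
  finally show ?thesis by simp
qed

text \<open>
  The basis element with index \<open>j\<close> is \<open>x\<^bsup>d div 2\<^esup> y\<^bsup>d mod 2\<^esup>\<close> for \<open>d = ramification_order (l - g) j\<close>; after
  translation of \<open>x\<close> by \<open>\<gamma>\<close>, \<open>d\<close> is its order of vanishing.
\<close>

definition ramification_order :: "nat \<Rightarrow> nat \<Rightarrow> nat" where
  "ramification_order m j = (if j < 2 * m then j else 2 * (j - m))"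

text \<open>The first \<open>2m\<close> orders are \<open>0, ..., 2m - 1\<close>, so these columns
  form a unitriangular Pascal block above a zero block. The remaining orders are
  \<open>2(m + b)\<close>, and the lower right block is the matrix of
  \<open>det_choose_double\<close>.\<close>

lemma det_choose_ramification_order:
  "det (mat (2 * m + (g + 1)) (2 * m + (g + 1)) (\<lambda>(i, j). int (ramification_order m j choose i))) =
    2 ^ ((g + 1) choose 2) * det (M_matrix (m + g) g)" (is "det ?A = _")
proof -
  let ?n = "2 * m" and ?k = "g + 1"
  let ?U = "mat ?n ?n (\<lambda>(i, j). int (j choose i))"
  let ?V = "mat ?n ?k (\<lambda>(i, j). int (2 * (m + j) choose i))"
  let ?W = "mat ?k ?k (\<lambda>(i, j). int (2 * (m + j) choose (2 * m + i)))"
  have "?A = four_block_mat ?U ?V (0\<^sub>m ?k ?n) ?W"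
  proof (rule eq_matI)
    fix i j
    assume "i < dim_row (four_block_mat ?U ?V (0\<^sub>m ?k ?n) ?W)"
      "j < dim_col (four_block_mat ?U ?V (0\<^sub>m ?k ?n) ?W)"
    then have ij: "i < ?n + ?k" "j < ?n + ?k" by simp_all
    consider "j < ?n" "i < ?n" | "j < ?n" "i \<ge> ?n" | "j \<ge> ?n" "i < ?n" | "j \<ge> ?n" "i \<ge> ?n"
      by linarith
    then show "?A $$ (i, j) = four_block_mat ?U ?V (0\<^sub>m ?k ?n) ?W $$ (i, j)"
    proof cases
      case 1
      then show ?thesis by (simp add: ramification_order_def)
    next
      case 2
      with ij show ?thesis by (simp add: ramification_order_def binomial_eq_0)
    next
      case 3
      then obtain b where "j = ?n + b" using le_Suc_ex by blast
      with 3 ij show ?thesis by (simp add: ramification_order_def distrib_left)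
    next
      case 4
      then obtain a b where "j = ?n + b" "i = ?n + a" using le_Suc_ex by metis
      with ij show ?thesis by (simp add: ramification_order_def distrib_left)
    qed
  qed simp_all
  then have "det ?A = det (four_block_mat ?U ?V (0\<^sub>m ?k ?n) ?W)"
    by (rule arg_cong)
  also have "\<dots> = det ?U * det ?W"
    by (rule det_four_block_mat_lower_left_zero[where n = ?n and m = ?k]) simp_all
  also have "det ?U = 1"
    by (rule det_unitriangular) auto
  finally show ?thesis
    by (simp only: det_choose_double mult_1_left)
qed

section \<open>Sums and parity classes of the vanishing orders\<close>

lemma strict_mono_ramification_order: "strict_mono (ramification_order m)"
  by (auto simp: strict_mono_def ramification_order_def)

lemma Suc_choose_two: "Suc n choose 2 = (n choose 2) + n"
  by (simp add: numeral_2_eq_2)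

text \<open>The order with index \<open>2m + b\<close> exceeds its index by \<open>b\<close>, the
  earlier ones by nothing. The total excess is the order of vanishing of the Wronskian.\<close>

lemma sum_ramification_order:
  "(\<Sum>j<2 * m + (g + 1). ramification_order m j) =
    (\<Sum>j<2 * m + (g + 1). j) + ((g + 1) choose 2)"
proof (induction g)
  case 0
  have "(\<Sum>j<2 * m. ramification_order m j) = (\<Sum>j<2 * m. j)"
    by (rule sum.cong) (simp_all add: ramification_order_def)
  then show ?case by (simp add: ramification_order_def)
next
  case (Suc g)
  have "ramification_order m (2 * m + (g + 1)) = 2 * m + (g + 1) + (g + 1)"
    by (simp add: ramification_order_def)
  with Suc Suc_choose_two[of "g + 1"] show ?case by simp
qed

text \<open>This adds up the exponents of \<open>x\<close> in the basis:
  \<open>0, ..., m - 1\<close> twice each, then \<open>m, ..., m + g\<close>. It is the power of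
  \<open>c\<close> in the leading coefficient.\<close>

lemma sum_ramification_order_div_2:
  "(\<Sum>j<2 * m + (g + 1). ramification_order m j div 2) = ((g + 1) choose 2) + (m + g) * m"
proof (induction g)
  case 0
  have "(\<Sum>j<2 * n. j div 2) + n = n * n" for n :: nat
    by (induction n) simp_all
  moreover have "(\<Sum>j<2 * m. ramification_order m j div 2) = (\<Sum>j<2 * m. j div 2)"
    by (rule sum.cong) (simp_all add: ramification_order_def)
  ultimately show ?case by (simp add: ramification_order_def)
next
  case (Suc g)
  have "ramification_order m (2 * m + (g + 1)) div 2 = m + (g + 1)"
    by (simp add: ramification_order_def)
  with Suc Suc_choose_two[of "g + 1"] show ?case by (simp add: algebra_simps)
qed

text \<open>For either exponent of \<open>y\<close>, the basis contains with a power of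
  \<open>x\<close> all lower powers, and lists them earlier. Hence powers of \<open>x - c\<close>
  expand triangularly in the basis.\<close>

lemma bij_betw_ramification_order:
  fixes m j :: nat
  defines "d \<equiv> ramification_order m"
  shows "bij_betw (\<lambda>k. d k div 2) {k. k \<le> j \<and> d k mod 2 = d j mod 2} {..d j div 2}"
proof (rule bij_betw_imageI)
  have mono: "d k \<le> d k' \<longleftrightarrow> k \<le> k'" for k k'
    unfolding d_def using strict_mono_ramification_order strict_mono_less_eq by blast
  show "inj_on (\<lambda>k. d k div 2) {k. k \<le> j \<and> d k mod 2 = d j mod 2}"
  proof (rule inj_onI)
    fix k k'
    assume "k \<in> {k. k \<le> j \<and> d k mod 2 = d j mod 2}" "k' \<in> {k. k \<le> j \<and> d k mod 2 = d j mod 2}"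
      and "d k div 2 = d k' div 2"
    then have "d k = d k'"
      using div_mult_mod_eq[of "d k" 2] div_mult_mod_eq[of "d k'" 2] by simp
    then show "k = k'"
      using mono by (metis order_antisym order_refl)
  qed
  show "(\<lambda>k. d k div 2) ` {k. k \<le> j \<and> d k mod 2 = d j mod 2} = {..d j div 2}"
  proof (intro equalityI subsetI)
    fix s assume "s \<in> {..d j div 2}"
    then have "s \<le> d j div 2" by simp
    then have le: "2 * s + d j mod 2 \<le> d j"
      using div_mult_mod_eq[of "d j" 2] by linarith
    \<comment> \<open>An order below \<open>2m\<close> is its own index; from \<open>2m\<close> on
      all orders are even, and \<open>2s\<close> has index \<open>m + s\<close>.\<close>
    have "\<exists>k. d k = 2 * s + d j mod 2"
    proof (cases "2 * s + d j mod 2 < 2 * m")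
      case True
      then have "d (2 * s + d j mod 2) = 2 * s + d j mod 2" by (simp add: d_def ramification_order_def)
      then show ?thesis ..
    next
      case False
      with le have "d j mod 2 = 0" by (auto simp: d_def ramification_order_def split: if_splits)
      with False have "d (m + s) = 2 * s + d j mod 2" by (auto simp: d_def ramification_order_def)
      then show ?thesis ..
    qed
    then obtain k where k: "d k = 2 * s + d j mod 2" ..
    with le mono have "k \<le> j" by metis
    with k show "s \<in> (\<lambda>k. d k div 2) ` {k. k \<le> j \<and> d k mod 2 = d j mod 2}"
      by (intro image_eqI[of _ _ k]) auto
  qed (use mono in \<open>auto intro: div_le_mono\<close>)
qed

text \<open>The base change from the powers of \<open>A\<close> to those of \<open>A - c\<close> is unitriangular.\<close>

lemma det_translate:
  fixes A Z :: "'r::comm_ring_1 fps" and c :: 'r and m n :: nat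
  defines "d \<equiv> ramification_order m"
  shows "det (mat n n (\<lambda>(i, j). ((A - fps_const c) ^ (d j div 2) * Z ^ (d j mod 2)) $ i)) =
    det (mat n n (\<lambda>(i, j). (A ^ (d j div 2) * Z ^ (d j mod 2)) $ i))"
proof -
  define E where "E i j = (A ^ (d j div 2) * Z ^ (d j mod 2)) $ i" for i j
  \<comment> \<open>These are the binomial coefficients expanding
    \<open>(A - c)^(d j div 2)\<close>; elements with different exponents of \<open>Z\<close> do not
    mix.\<close>
  define V where "V k j = (if d k mod 2 = d j mod 2
    then of_nat (d j div 2 choose (d k div 2)) * (- c) ^ (d j div 2 - d k div 2) else 0)" for k j
  have less: "d k < d k' \<longleftrightarrow> k < k'" for k k'
    unfolding d_def using strict_mono_ramification_order strict_mono_less by blast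
  have V_zero: "V k j = 0" if "j < k" for k j
  proof (cases "d k mod 2 = d j mod 2")
    case True
    have "d j < d k" using that less by simp
    with True have "d j div 2 < d k div 2"
      using div_mult_mod_eq[of "d k" 2] div_mult_mod_eq[of "d j" 2] by linarith
    then show ?thesis by (simp add: V_def binomial_eq_0)
  qed (simp add: V_def)
  have expand: "((A - fps_const c) ^ (d j div 2) * Z ^ (d j mod 2)) $ i = (\<Sum>k<n. E i k * V k j)"
    if "j < n" for i j
  proof -
    let ?e = "d j mod 2"
    let ?t = "\<lambda>s. (A ^ s * Z ^ ?e) $ i * (of_nat (d j div 2 choose s) * (- c) ^ (d j div 2 - s))"
    have "(A - fps_const c) ^ (d j div 2) = (A + fps_const (- c)) ^ (d j div 2)"
      by (metis diff_conv_add_uminus fps_const_neg)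
    also have "\<dots> = (\<Sum>s\<le>d j div 2. A ^ s *
        fps_const (of_nat (d j div 2 choose s) * (- c) ^ (d j div 2 - s)))"
      unfolding binomial_ring
      by (simp add: fps_const_power fps_of_nat[symmetric] mult_ac flip: fps_const_mult del: fps_const_neg)
    finally have "((A - fps_const c) ^ (d j div 2) * Z ^ ?e) $ i = (\<Sum>s\<le>d j div 2. ?t s)"
      by (simp add: sum_distrib_right fps_sum_nth mult.assoc mult.commute[of "fps_const _"])
        (simp add: mult.assoc[symmetric])
    \<comment> \<open>The exponents \<open>s\<close> of \<open>A\<close> are traded for the indices
      of the basis elements having them.\<close>
    also have "\<dots> = (\<Sum>k\<in>{k. k \<le> j \<and> d k mod 2 = d j mod 2}. ?t (d k div 2))"
      unfolding d_def by (rule sum.reindex_bij_betw[OF bij_betw_ramification_order, symmetric])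
    also have "\<dots> = (\<Sum>k<n. E i k * V k j)"
    proof (rule sum.mono_neutral_cong_left)
      show "\<forall>k\<in>{..<n} - {k. k \<le> j \<and> d k mod 2 = d j mod 2}. E i k * V k j = 0"
      proof
        fix k assume "k \<in> {..<n} - {k. k \<le> j \<and> d k mod 2 = d j mod 2}"
        then show "E i k * V k j = 0"
          by (cases "j < k") (simp_all add: V_zero, simp add: V_def)
      qed
    qed (use that in \<open>auto simp: E_def V_def\<close>)
    finally show ?thesis .
  qed
  have "mat n n (\<lambda>(i, j). ((A - fps_const c) ^ (d j div 2) * Z ^ (d j mod 2)) $ i) =
      mat n n (\<lambda>(i, j). E i j) * mat n n (\<lambda>(i, j). V i j)"
    unfolding mat_mult_entries by (rule cong_mat) (simp_all add: expand)
  then have "det (mat n n (\<lambda>(i, j). ((A - fps_const c) ^ (d j div 2) * Z ^ (d j mod 2)) $ i)) =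
      det (mat n n (\<lambda>(i, j). E i j)) * det (mat n n (\<lambda>(i, j). V i j))"
    by (simp add: det_mult[of _ n])
  also have "det (mat n n (\<lambda>(i, j). V i j)) = 1"
    by (rule det_unitriangular) (simp_all add: V_zero, simp add: V_def)
  finally show ?thesis by (simp add: E_def)
qed

section \<open>Leading terms of power series\<close>

text \<open>The element \<open>X + z\<close> of \<open>k[[X]][[z]]\<close>, where \<open>z\<close> is the outer variable.\<close>

abbreviation sum_var :: "'k::comm_ring_1 fps fps" where
  "sum_var \<equiv> fps_const fps_X + fps_X"

lemma nth_sum_var_power:
  "(sum_var ^ d :: 'k::comm_ring_1 fps fps) $ i = of_nat (d choose i) * fps_X ^ (d - i)"
proof -
  have "(sum_var ^ d :: 'k fps fps) $ i =
      (\<Sum>k\<le>d. if k = i then of_nat (d choose i) * fps_X ^ (d - i) else 0)"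
    unfolding add.commute[of "fps_const fps_X"] binomial_ring fps_sum_nth
    by (intro sum.cong)
      (auto simp: fps_of_nat[symmetric] fps_const_power mult.assoc fps_X_power_iff)
  then show ?thesis by (simp add: binomial_eq_0)
qed

text \<open>The \<open>z^q\<close> coefficient of \<open>(X + z)^d\<close> has degree
  \<open>d - q\<close> in \<open>X\<close>. Multiplying by \<open>X^i\<close> thus yields a multiple
  of \<open>X^d\<close>, even for \<open>i > d\<close>, and only the summand \<open>q = i\<close>
  survives at \<open>X = 0\<close>.\<close>

lemma nth_sum_var_power_mult:
  fixes U :: "'k::comm_ring_1 fps fps"
  shows "\<exists>G. fps_X ^ i * (sum_var ^ d * U) $ i = fps_X ^ d * G \<and>
    G $ 0 = of_nat (d choose i) * U $ 0 $ 0"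
proof (intro exI conjI)
  let ?G = "\<Sum>q=0..i. of_nat (d choose q) * fps_X ^ (i - q) * U $ (i - q)"
  have "fps_X ^ i * (of_nat (d choose q) * fps_X ^ (d - q)) =
      fps_X ^ d * (of_nat (d choose q) * fps_X ^ (i - q) :: 'k fps)" if "q \<le> i" for q
  proof (cases "q \<le> d")
    case True
    with that have "fps_X ^ i * fps_X ^ (d - q) = (fps_X ^ d * fps_X ^ (i - q) :: 'k fps)"
      by (simp flip: power_add)
    then show ?thesis by (metis mult.left_commute)
  qed (simp add: binomial_eq_0)
  then show "fps_X ^ i * (sum_var ^ d * U) $ i = fps_X ^ d * ?G"
    unfolding fps_mult_nth nth_sum_var_power sum_distrib_left
    by (intro sum.cong) (simp_all add: mult.assoc[symmetric])
  have "?G $ 0 = (\<Sum>q=0..i. if q = i then of_nat (d choose i) * U $ 0 $ 0 else 0)"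
    unfolding fps_sum_nth
    by (intro sum.cong) (auto simp: fps_of_nat[symmetric])
  then show "?G $ 0 = of_nat (d choose i) * U $ 0 $ 0" by simp
qed

lemma lowest_order_term_fps_X_power_mult:
  fixes U :: "'k::field fps"
  assumes "U $ 0 \<noteq> 0"
  shows "fps_X ^ n * U \<noteq> 0"
    and "lowest_order_term (fps_X ^ n * U) = fps_const (U $ 0) * fps_X ^ n"
proof -
  have "U \<noteq> 0" using assms by auto
  then show "fps_X ^ n * U \<noteq> 0" by simp
  moreover have "subdegree (fps_X ^ n * U) = n"
    using assms by (intro subdegreeI) (auto simp: fps_X_power_mult_nth)
  ultimately show "lowest_order_term (fps_X ^ n * U) = fps_const (U $ 0) * fps_X ^ n"
    by (simp add: lowest_order_term_def fps_X_power_mult_nth)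
qed

lemma comm_ring_hom_nth_0: "comm_ring_hom (\<lambda>\<phi> :: 'k::comm_ring_1 fps. \<phi> $ 0)"
  by unfold_locales simp_all

text \<open>Scaling the rows of \<open>E\<close> by \<open>X^i\<close> equals scaling the columns of
  \<open>G\<close> by \<open>X^(d j)\<close>; then cancel \<open>X^(0 + ... + (n - 1))\<close>. The
  constant term is a ring homomorphism, so it commutes with \<open>det\<close>.\<close>

lemma det_leading_term:
  fixes E G :: "nat \<Rightarrow> nat \<Rightarrow> 'k::field fps" and d :: "nat \<Rightarrow> nat"
  assumes EG: "\<And>i j. fps_X ^ i * E i j = fps_X ^ d j * G i j"
    and d: "(\<Sum>j<n. d j) = (\<Sum>j<n. j) + b"
  shows "det (mat n n (\<lambda>(i, j). E i j)) = fps_X ^ b * det (mat n n (\<lambda>(i, j). G i j))"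
    and "det (mat n n (\<lambda>(i, j). G i j)) $ 0 = det (mat n n (\<lambda>(i, j). G i j $ 0))"
proof -
  have "fps_X ^ (\<Sum>i<n. i) * det (mat n n (\<lambda>(i, j). E i j)) =
      det (mat n n (\<lambda>(i, j). fps_X ^ i * E i j * 1))"
    by (subst det_scale) (simp add: power_sum)
  also have "mat n n (\<lambda>(i, j). fps_X ^ i * E i j * 1) = mat n n (\<lambda>(i, j). 1 * G i j * fps_X ^ d j)"
    by (rule cong_mat) (simp_all add: EG mult.commute[of "G _ _"])
  also have "det \<dots> = fps_X ^ (\<Sum>j<n. d j) * det (mat n n (\<lambda>(i, j). G i j))"
    by (subst det_scale) (simp add: power_sum)
  finally show "det (mat n n (\<lambda>(i, j). E i j)) = fps_X ^ b * det (mat n n (\<lambda>(i, j). G i j))"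
    by (simp add: d power_add)
  interpret comm_ring_hom "\<lambda>\<phi> :: 'k fps. \<phi> $ 0" by (rule comm_ring_hom_nth_0)
  have "map_mat (\<lambda>\<phi>. \<phi> $ 0) (mat n n (\<lambda>(i, j). G i j)) = mat n n (\<lambda>(i, j). G i j $ 0)"
    by (rule eq_matI) auto
  then show "det (mat n n (\<lambda>(i, j). G i j)) $ 0 = det (mat n n (\<lambda>(i, j). G i j $ 0))"
    using hom_det[of "mat n n (\<lambda>(i, j). G i j)"] by simp
qed

section \<open>The monomial basis in terms of the vanishing orders\<close>

lemma concat_pairs_eq_map:
  "concat (map (\<lambda>i. [F i, G i]) [0..<n]) = map (\<lambda>j. if even j then F (j div 2) else G (j div 2)) [0..<2 * n]"
  by (induction n) auto

lemma length_monomial_basis: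
  assumes "g < l"
  shows "length (monomial_basis l g x y) = 2 * (l - g) + (g + 1)"
  using assms by (simp add: monomial_basis_def concat_pairs_eq_map)

lemma nth_monomial_basis:
  assumes "g < l" "j < 2 * (l - g) + (g + 1)"
  shows "monomial_basis l g x y ! j =
    x ^ (ramification_order (l - g) j div 2) * y ^ (ramification_order (l - g) j mod 2)"
proof (cases "j < 2 * (l - g)")
  case True
  then show ?thesis
    by (auto simp: monomial_basis_def concat_pairs_eq_map nth_append ramification_order_def
        elim: oddE)
next
  case False
  then have "[l - g..<l + 1] ! (j - 2 * (l - g)) = j - (l - g)"
    using assms by (subst nth_upt) auto
  with False assms show ?thesis
    by (simp add: monomial_basis_def concat_pairs_eq_map nth_append ramification_order_def del: upt_Suc)
qed


section \<open>The local ring and Taylor expansions\<close>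

text \<open>
  The minimal polynomial of a common zero of \<open>p\<close> and \<open>q\<close> in some extension field divides both, so
  that they also have a common zero in the algebraic closure.
\<close>

lemma common_root_alg_closure:
  fixes p q :: "'a::field poly" and h :: "'a \<Rightarrow> 'k::field"
  assumes "field_hom h" and p: "p \<noteq> 0" "poly (map_poly h p) c = 0" and q: "poly (map_poly h q) c = 0"
  shows "\<exists>a. poly (map_poly to_ac p) a = 0 \<and> poly (map_poly to_ac q) a = 0"
proof -
  interpret h: field_hom h by fact
  interpret hp: map_poly_comm_ring_hom h ..
  interpret ac: comm_ring_hom "to_ac :: 'a \<Rightarrow> 'a alg_closure"
    by unfold_locales simp_all
  interpret acp: map_poly_comm_ring_hom "to_ac :: 'a \<Rightarrow> 'a alg_closure" ..
  define S where "S = {r :: 'a poly. r \<noteq> 0 \<and> poly (map_poly h r) c = 0}"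
  have "p \<in> S" using p by (simp add: S_def)
  \<comment> \<open>Up to a scalar, \<open>r\<close> is the minimal polynomial of
    \<open>c\<close>.\<close>
  then obtain r where r: "r \<in> S" and min: "\<And>r'. degree r' < degree r \<Longrightarrow> r' \<notin> S"
    using ex_has_least_nat[of "\<lambda>r. r \<in> S" p degree] by (auto simp flip: not_le)
  have dvd: "r dvd s" if s: "poly (map_poly h s) c = 0" for s
  proof -
    have "s = s div r * r + s mod r \<and> (s mod r = 0 \<or> degree (s mod r) < degree r)"
      using r degree_mod_less[of r s] by (simp add: S_def)
    then obtain u t where ut: "s = u * r + t" "t = 0 \<or> degree t < degree r"
      by meson
    have "poly (map_poly h t) c = 0"
      using s r unfolding ut(1) S_def hp.hom_add hp.hom_mult by simp
    then have "t = 0"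
      using ut(2) min[of t] by (auto simp: S_def)
    with ut show ?thesis by simp
  qed
  have "degree r \<noteq> 0"
  proof
    assume "degree r = 0"
    then obtain a where "r = [:a:]" by (rule degree_eq_zeroE)
    with r show False by (simp add: S_def h.map_poly_pCons_hom)
  qed
  moreover have "degree (map_poly to_ac r) = degree r"
    by (simp add: degree_map_poly)
  ultimately have "degree (map_poly to_ac r) > 0"
    by simp
  then obtain a where a: "poly (map_poly to_ac r) a = 0"
    using alg_closed_imp_poly_has_root by blast
  have "poly (map_poly to_ac s) a = 0" if rs: "r dvd s" for s
  proof -
    obtain u where "s = r * u" using rs by (rule dvdE)
    with a show ?thesis by (simp add: acp.hom_mult)
  qed
  then show ?thesis using dvd[OF p(2)] dvd[OF q] by (intro exI[of _ a] conjI)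
qed

section \<open>The local ring at the ramification point\<close>

context affine_ramification_point
begin

sublocale base_poly: map_poly_comm_ring_hom \<iota> ..
sublocale residue_poly: map_poly_comm_ring_hom \<kappa> ..

text \<open>Smoothness concerns points over the algebraic closure of \<open>F\<close>, whereas
  \<gamma> lies in another extension. A common zero of \<open>f\<close> and \<open>f'\<close> is
  therefore moved to that closure, where \<open>(a, 0)\<close> would be singular.\<close>

lemma pderiv_f_nonzero: "poly (map_poly \<kappa> (pderiv f)) \<gamma> \<noteq> 0"
proof
  assume "poly (map_poly \<kappa> (pderiv f)) \<gamma> = 0"
  moreover have "f \<noteq> 0" using degree_f by auto
  ultimately obtain a where "poly (map_poly to_ac f) a = 0" "poly (map_poly to_ac (pderiv f)) a = 0"
    using common_root_alg_closure[OF residue.field_hom_axioms _ root] by blast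
  moreover have "map_poly to_ac (pderiv f) = pderiv (map_poly to_ac f)"
    by (intro poly_eqI) (simp add: coeff_pderiv coeff_map_poly)
  ultimately show False
    using smooth[of 0 a] by simp
qed

definition affine_function :: "'a poly \<Rightarrow> 'a poly \<Rightarrow> 'L" where
  "affine_function a b = poly (map_poly \<iota> a) x + poly (map_poly \<iota> b) x * y"

lemma affine_function_add:
  "affine_function a b + affine_function c d = affine_function (a + c) (b + d)"
  by (simp add: affine_function_def hom_distribs algebra_simps)

lemma affine_function_mult:
  "affine_function a b * affine_function c d = affine_function (a * c + b * d * f) (a * d + b * c)"
proof -
  have "y * y = poly (map_poly \<iota> f) x"
    using curve_equation by (simp add: power2_eq_square)
  then have "poly (map_poly \<iota> b) x * y * (poly (map_poly \<iota> d) x * y) =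
      poly (map_poly \<iota> (b * d * f)) x"
    by (simp add: hom_distribs mult_ac)
  then show ?thesis
    by (simp add: affine_function_def hom_distribs distrib_left distrib_right mult_ac add_ac)
qed

text \<open>If \<open>c(x) + d(x) y\<close> vanished, so would its norm \<open>c^2 - d^2 f\<close>,
  first at \<open>x\<close> and then, by transcendence, as a polynomial; at \<gamma> this reads
  \<open>c(\<gamma>)^2 = 0\<close>.\<close>

lemma affine_function_nonzero:
  assumes "poly (map_poly \<kappa> c) \<gamma> \<noteq> 0"
  shows "affine_function c d \<noteq> 0"
proof
  assume "affine_function c d = 0"
  then have "poly (map_poly \<iota> c) x = - (poly (map_poly \<iota> d) x * y)"
    by (simp add: affine_function_def eq_neg_iff_add_eq_0)
  then have "poly (map_poly \<iota> (c * c - d * d * f)) x = 0"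
    using curve_equation by (simp add: hom_distribs power2_eq_square)
  then have "c * c - d * d * f = 0"
    using x_transcendental by blast
  then have "poly (map_poly \<kappa> (c * c)) \<gamma> = poly (map_poly \<kappa> (d * d * f)) \<gamma>"
    by simp
  with assms root show False
    by (simp add: hom_distribs)
qed

lemma local_ring_iff:
  "\<phi> \<in> local_ring \<longleftrightarrow>
    (\<exists>a b c d. \<phi> = affine_function a b / affine_function c d \<and> poly (map_poly \<kappa> c) \<gamma> \<noteq> 0)"
  unfolding local_ring_def affine_function_def by blast

lemma affine_function_in_local_ring: "affine_function a b \<in> local_ring"
  unfolding local_ring_iff
  by (intro exI[of _ a] exI[of _ b] exI[of _ 1] exI[of _ 0]) (simp add: affine_function_def)

lemma poly_in_local_ring: "poly (map_poly \<iota> p) x \<in> local_ring"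
  using affine_function_in_local_ring[of p 0] by (simp add: affine_function_def)

lemma const_in_local_ring: "\<iota> c \<in> local_ring"
  using poly_in_local_ring[of "[:c:]"] by (simp add: hom_distribs)

lemma x_in_local_ring: "x \<in> local_ring"
  using poly_in_local_ring[of "[:0, 1:]"] by simp

lemma y_in_local_ring: "y \<in> local_ring"
  using affine_function_in_local_ring[of 0 1] by (simp add: affine_function_def)

lemma local_ring_add_mult:
  assumes "\<phi> \<in> local_ring" "\<psi> \<in> local_ring"
  shows "\<phi> + \<psi> \<in> local_ring" and "\<phi> * \<psi> \<in> local_ring"
proof -
  obtain a b c d where 1: "\<phi> = affine_function a b / affine_function c d"
    "poly (map_poly \<kappa> c) \<gamma> \<noteq> 0"
    using assms(1) unfolding local_ring_iff by blast
  obtain a' b' c' d' where 2: "\<psi> = affine_function a' b' / affine_function c' d'"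
    "poly (map_poly \<kappa> c') \<gamma> \<noteq> 0"
    using assms(2) unfolding local_ring_iff by blast
  \<comment> \<open>The product of the denominators has value
    \<open>c(\<gamma>) c'(\<gamma>)\<close>, because \<open>f(\<gamma>) = 0\<close>.\<close>
  have nz: "poly (map_poly \<kappa> (c * c' + d * d' * f)) \<gamma> \<noteq> 0"
    using 1 2 root by (simp add: hom_distribs)
  have "\<phi> + \<psi> = (affine_function a b * affine_function c' d' +
      affine_function a' b' * affine_function c d) / (affine_function c d * affine_function c' d')"
    using 1 2 by (simp add: affine_function_nonzero add_frac_eq)
  then show "\<phi> + \<psi> \<in> local_ring"
    unfolding local_ring_iff affine_function_mult affine_function_add using nz by blast
  have "\<phi> * \<psi> = (affine_function a b * affine_function a' b') /
      (affine_function c d * affine_function c' d')"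
    using 1 2 by simp
  then show "\<phi> * \<psi> \<in> local_ring"
    unfolding local_ring_iff affine_function_mult using nz by blast
qed

lemma local_ring_0_1: "0 \<in> local_ring" "1 \<in> local_ring"
  using const_in_local_ring[of 0] const_in_local_ring[of 1] by simp_all

lemma local_ring_of_int: "of_int n \<in> local_ring"
  using const_in_local_ring[of "of_int n"] by (simp add: base.hom_of_int)

lemma local_ring_sum: "(\<And>s. s \<in> S \<Longrightarrow> F s \<in> local_ring) \<Longrightarrow> sum F S \<in> local_ring"
  by (induction S rule: infinite_finite_induct) (auto simp: local_ring_0_1 local_ring_add_mult)

lemma local_ring_prod: "(\<And>s. s \<in> S \<Longrightarrow> F s \<in> local_ring) \<Longrightarrow> prod F S \<in> local_ring"
  by (induction S rule: infinite_finite_induct) (auto simp: local_ring_0_1 local_ring_add_mult)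

lemma local_ring_power: "\<phi> \<in> local_ring \<Longrightarrow> \<phi> ^ n \<in> local_ring"
  by (induction n) (auto simp: local_ring_0_1 local_ring_add_mult)

end

section \<open>Hasse derivatives and expansions in the completed local ring\<close>

locale hasse_expansion = affine_ramification_point \<iota> f g x y \<kappa> \<gamma>
  for \<iota> :: "'a::field \<Rightarrow> 'L::field" and f :: "'a poly" and g :: nat and x y :: 'L
    and \<kappa> :: "'a \<Rightarrow> 'k::field" and \<gamma> :: 'k +
  fixes D :: "nat \<Rightarrow> 'L \<Rightarrow> 'L" and e :: "'L \<Rightarrow> 'k fps"
  assumes hasse: "hasse_derivatives D" and expansion: "expansion e"
begin

lemma D_in_local_ring: "\<phi> \<in> local_ring \<Longrightarrow> D k \<phi> \<in> local_ring"
  using hasse unfolding hasse_derivatives_def by blast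

lemma e_add: "\<phi> \<in> local_ring \<Longrightarrow> \<psi> \<in> local_ring \<Longrightarrow> e (\<phi> + \<psi>) = e \<phi> + e \<psi>"
  and e_mult: "\<phi> \<in> local_ring \<Longrightarrow> \<psi> \<in> local_ring \<Longrightarrow> e (\<phi> * \<psi>) = e \<phi> * e \<psi>"
  and e_const: "e (\<iota> c) = fps_const (\<kappa> c)"
  using expansion unfolding expansion_def by blast+

lemma e_of_int: "e (of_int n) = of_int n"
  using e_const[of "of_int n"] by (simp add: base.hom_of_int residue.hom_of_int fps_of_int)

lemma e_0: "e 0 = 0" and e_1: "e 1 = 1"
  using e_of_int[of 0] e_of_int[of 1] by simp_all

lemma e_sum: "(\<And>s. s \<in> S \<Longrightarrow> F s \<in> local_ring) \<Longrightarrow> e (sum F S) = (\<Sum>s\<in>S. e (F s))"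
  by (induction S rule: infinite_finite_induct) (auto simp: e_0 e_add local_ring_sum)

lemma e_prod: "(\<And>s. s \<in> S \<Longrightarrow> F s \<in> local_ring) \<Longrightarrow> e (prod F S) = (\<Prod>s\<in>S. e (F s))"
  by (induction S rule: infinite_finite_induct) (auto simp: e_1 e_mult local_ring_prod)

lemma e_power: "\<phi> \<in> local_ring \<Longrightarrow> e (\<phi> ^ n) = e \<phi> ^ n"
  by (induction n) (auto simp: e_1 e_mult local_ring_power)

text \<open>As \<open>e\<close> respects sums and products only on the local ring, it is passed
  through the Leibniz formula term by term.\<close>

lemma e_det:
  assumes "\<And>i j. i < n \<Longrightarrow> j < n \<Longrightarrow> A i j \<in> local_ring"
  shows "e (det (mat n n (\<lambda>(i, j). A i j))) = det (mat n n (\<lambda>(i, j). e (A i j)))"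
proof -
  have eq: "(\<Prod>i = 0..<n. mat n n (\<lambda>(i, j). B i j) $$ (i, p i)) = (\<Prod>i = 0..<n. B i (p i))"
    if "p permutes {0..<n}" for p and B :: "nat \<Rightarrow> nat \<Rightarrow> 'b::comm_ring_1"
    using permutes_in_image[OF that] by (intro prod.cong) auto
  have in_ring: "A i (p i) \<in> local_ring" if "p permutes {0..<n}" "i \<in> {0..<n}" for p i
    using assms permutes_in_image[OF that(1)] that(2) by auto
  have "e (det (mat n n (\<lambda>(i, j). A i j))) =
      e (\<Sum>p | p permutes {0..<n}. of_int (sign p) * (\<Prod>i = 0..<n. A i (p i)))"
    by (simp add: det_def eq cong: conj_cong)
  also have "\<dots> = (\<Sum>p | p permutes {0..<n}. e (of_int (sign p) * (\<Prod>i = 0..<n. A i (p i))))"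
    by (rule e_sum, rule local_ring_add_mult(2)[OF local_ring_of_int local_ring_prod[OF in_ring]]) simp_all
  also have "\<dots> = (\<Sum>p | p permutes {0..<n}. of_int (sign p) * (\<Prod>i = 0..<n. e (A i (p i))))"
  proof (rule sum.cong[OF refl])
    fix p assume "p \<in> {p. p permutes {0..<n}}"
    then have p: "p permutes {0..<n}" by simp
    have "e (of_int (sign p) * (\<Prod>i = 0..<n. A i (p i))) =
        e (of_int (sign p)) * e (\<Prod>i = 0..<n. A i (p i))"
      by (intro e_mult local_ring_of_int local_ring_prod in_ring p)
    also have "e (\<Prod>i = 0..<n. A i (p i)) = (\<Prod>i = 0..<n. e (A i (p i)))"
      by (intro e_prod in_ring p)
    finally show "e (of_int (sign p) * (\<Prod>i = 0..<n. A i (p i))) =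
        of_int (sign p) * (\<Prod>i = 0..<n. e (A i (p i)))"
      by (simp only: e_of_int)
  qed
  also have "\<dots> = det (mat n n (\<lambda>(i, j). e (A i j)))"
    by (simp add: det_def eq cong: conj_cong)
  finally show ?thesis .
qed

text \<open>The expansion of \<open>\<phi>\<close> along \<open>y \<mapsto> y + z\<close>, as a power series in the outer variable \<open>z\<close>.\<close>

definition taylor :: "'L \<Rightarrow> 'k fps fps" where
  "taylor \<phi> = Abs_fps (\<lambda>k. e (D k \<phi>))"

lemma taylor_nth: "taylor \<phi> $ k = e (D k \<phi>)"
  by (simp add: taylor_def)

lemma taylor_add:
  "\<phi> \<in> local_ring \<Longrightarrow> \<psi> \<in> local_ring \<Longrightarrow> taylor (\<phi> + \<psi>) = taylor \<phi> + taylor \<psi>"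
  using hasse unfolding hasse_derivatives_def
  by (intro fps_ext) (simp add: taylor_nth e_add)

text \<open>The product rule for Hasse derivatives is the Cauchy product of series in
  \<open>z\<close>.\<close>

lemma taylor_mult:
  assumes "\<phi> \<in> local_ring" "\<psi> \<in> local_ring"
  shows "taylor (\<phi> * \<psi>) = taylor \<phi> * taylor \<psi>"
proof (rule fps_ext)
  fix k
  have "D k (\<phi> * \<psi>) = (\<Sum>i\<le>k. D i \<phi> * D (k - i) \<psi>)"
    using hasse assms unfolding hasse_derivatives_def by blast
  then show "taylor (\<phi> * \<psi>) $ k = (taylor \<phi> * taylor \<psi>) $ k"
    using assms by (simp add: taylor_nth fps_mult_nth e_sum e_mult D_in_local_ring
        local_ring_add_mult atLeast0AtMost)
qed

lemma taylor_y_power: "taylor (y ^ n) = sum_var ^ n"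
proof (rule fps_ext)
  fix k
  have "e y = fps_X" using expansion unfolding expansion_def by blast
  \<comment> \<open>The binomial coefficient is written as an integer so that
    \<open>e_of_int\<close> applies.\<close>
  moreover have "D k (y ^ n) = of_int (int (n choose k)) * y ^ (n - k)"
    using hasse unfolding hasse_derivatives_def by simp
  ultimately show "taylor (y ^ n) $ k = sum_var ^ n $ k"
    by (simp add: taylor_nth nth_sum_var_power e_mult e_of_int e_power y_in_local_ring
        local_ring_of_int local_ring_power del: of_int_of_nat_eq) simp
qed

lemma taylor_1: "taylor 1 = 1"
  using taylor_y_power[of 0] by simp

text \<open>By \<open>F\<close>-linearity this reduces to the derivatives of
  \<open>1 = y^0\<close>.\<close>

lemma taylor_const: "taylor (\<iota> c) = fps_const (fps_const (\<kappa> c))"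
proof (rule fps_ext)
  fix k
  have "D k (\<iota> c * 1) = \<iota> c * D k 1"
    using hasse local_ring_0_1 unfolding hasse_derivatives_def by blast
  then have "taylor (\<iota> c) $ k = fps_const (\<kappa> c) * taylor 1 $ k"
    by (simp add: taylor_nth e_mult e_const const_in_local_ring D_in_local_ring local_ring_0_1)
  then show "taylor (\<iota> c) $ k = fps_const (fps_const (\<kappa> c)) $ k"
    by (simp add: taylor_1)
qed

lemma taylor_power: "\<phi> \<in> local_ring \<Longrightarrow> taylor (\<phi> ^ n) = taylor \<phi> ^ n"
  by (induction n) (auto simp: taylor_1 taylor_mult local_ring_power)

lemma taylor_poly:
  "taylor (poly (map_poly \<iota> p) x) = poly (map_poly (\<lambda>c. fps_const (fps_const c)) (map_poly \<kappa> p)) (taylor x)"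
proof (induction p)
  interpret C: comm_ring_hom "\<lambda>c :: 'k. fps_const (fps_const c)" by unfold_locales simp_all
  case 0
  then show ?case using taylor_const[of 0] by simp
next
  interpret C: comm_ring_hom "\<lambda>c :: 'k. fps_const (fps_const c)" by unfold_locales simp_all
  case (pCons a p)
  have "taylor (poly (map_poly \<iota> (pCons a p)) x) = taylor (\<iota> a + x * poly (map_poly \<iota> p) x)"
    by (simp only: base.map_poly_pCons_hom poly_pCons)
  also have "\<dots> = taylor (\<iota> a) + taylor x * taylor (poly (map_poly \<iota> p) x)"
    by (simp only: taylor_add taylor_mult const_in_local_ring x_in_local_ring
        poly_in_local_ring local_ring_add_mult)
  also have "\<dots> = poly (map_poly (\<lambda>c. fps_const (fps_const c)) (map_poly \<kappa> (pCons a p))) (taylor x)"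
    by (simp only: pCons.IH taylor_const residue.map_poly_pCons_hom C.map_poly_pCons_hom poly_pCons)
  finally show ?case .
qed

lemma taylor_x_nth_0_0: "taylor x $ 0 $ 0 = \<gamma>"
proof -
  have "D 0 x = x" using hasse x_in_local_ring unfolding hasse_derivatives_def by blast
  moreover have "e x $ 0 = \<gamma>" using expansion unfolding expansion_def by blast
  ultimately show ?thesis by (simp add: taylor_nth)
qed

text \<open>Divide \<open>f(X) = (X - \<gamma>) q(X)\<close>, where \<open>q(\<gamma>) = f'(\<gamma>) \<noteq> 0\<close>, at \<open>X = x\<close>.\<close>

lemma taylor_x:
  "\<exists>U. taylor x - fps_const (fps_const \<gamma>) = sum_var\<^sup>2 * U \<and> U $ 0 $ 0 \<noteq> 0"
proof -
  let ?C = "\<lambda>c :: 'k. fps_const (fps_const c)"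
  interpret C: comm_ring_hom ?C by unfold_locales simp_all
  interpret Cp: map_poly_comm_ring_hom ?C ..
  interpret ev: comm_ring_hom "\<lambda>P :: 'k fps fps. P $ 0 $ 0" by unfold_locales simp_all
  obtain q where q: "map_poly \<kappa> f = [:- \<gamma>, 1:] * q"
    using root poly_eq_0_iff_dvd by (metis dvdE)
  define v where "v = poly (map_poly ?C q) (taylor x)"
  have "poly (map_poly \<kappa> (pderiv f)) \<gamma> = poly (pderiv (map_poly \<kappa> f)) \<gamma>"
    by (rule arg_cong[where f = "\<lambda>p. poly p \<gamma>"], intro poly_eqI)
      (simp add: coeff_pderiv residue.hom_mult residue.hom_add residue.hom_of_nat)
  also have "\<dots> = poly q \<gamma>"
    unfolding q pderiv_mult by (simp add: pderiv_pCons)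
  finally have "poly q \<gamma> \<noteq> 0"
    using pderiv_f_nonzero by simp
  \<comment> \<open>Setting both variables to zero sends \<open>x\<close> to \<gamma>, so
    \<open>v\<close> has the value \<open>q(\<gamma>)\<close>, which is nonzero.\<close>
  moreover have "poly (map_poly ?C p) (taylor x) $ 0 $ 0 = poly p \<gamma>" for p
    by (induction p) (simp_all add: taylor_x_nth_0_0 C.map_poly_pCons_hom)
  ultimately have v: "v $ 0 $ 0 \<noteq> 0" by (simp add: v_def)
  \<comment> \<open>Invertibility is lifted in two stages, from \<open>k\<close> to
    \<open>k[[X]]\<close> and then to \<open>k[[X]][[z]]\<close>.\<close>
  then have "v $ 0 * inverse (v $ 0) = 1"
    by (simp add: inverse_mult_eq_1')
  then obtain w where w: "v * w = 1"
    using fps_right_inverse by blast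
  have "sum_var\<^sup>2 = taylor (poly (map_poly \<iota> f) x)"
    by (simp flip: curve_equation add: taylor_y_power)
  also have "\<dots> = (taylor x - ?C \<gamma>) * v"
    unfolding taylor_poly q v_def Cp.hom_mult poly_mult by (simp add: C.map_poly_pCons_hom)
  finally have "sum_var\<^sup>2 * w = taylor x - ?C \<gamma>"
    using w by (simp add: mult.assoc)
  moreover have "w $ 0 $ 0 \<noteq> 0"
    using w ev.hom_mult[of v w] by auto
  ultimately show ?thesis by metis
qed

section \<open>The Wronskian in power series and its lowest-order term\<close>

lemma two_nonzero: "(2 :: 'k) \<noteq> 0"
proof
  assume "(2 :: 'k) = 0"
  then have "\<kappa> (of_nat 2) = 0" by (simp only: residue.hom_of_nat) simp
  then have "of_nat 2 = (0 :: 'a)" by (simp only: residue.hom_0_iff)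
  then have "CHAR('a) dvd 2" by (simp only: of_nat_eq_0_iff_char_dvd)
  moreover have "CHAR('a) \<noteq> 1" by simp
  ultimately show False
    using char_ne_2 prime_nat_iff two_is_prime_nat by blast
qed

text \<open>The derivatives of a basis element are the \<open>z\<close>-coefficients of its Taylor
  series, which is a product of powers of those of \<open>x\<close> and \<open>y\<close>.\<close>

lemma e_hasse_wronskian_monomial_basis:
  fixes l :: nat
  defines "m \<equiv> l - g"
  defines "n \<equiv> 2 * m + (g + 1)"
  defines "d \<equiv> ramification_order m"
  assumes l: "g < l"
  shows "e (hasse_wronskian D (monomial_basis l g x y)) =
    det (mat n n (\<lambda>(i, j). (taylor x ^ (d j div 2) * sum_var ^ (d j mod 2)) $ i))"
proof -
  have len: "length (monomial_basis l g x y) = n"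
    using l by (simp add: length_monomial_basis n_def m_def)
  have in_ring: "x ^ a * y ^ b \<in> local_ring" for a b
    by (intro local_ring_add_mult local_ring_power x_in_local_ring y_in_local_ring)
  have "hasse_wronskian D (monomial_basis l g x y) =
      det (mat n n (\<lambda>(i, j). D i (x ^ (d j div 2) * y ^ (d j mod 2))))"
    unfolding hasse_wronskian_def len
    by (rule arg_cong[where f = det], rule cong_mat)
      (use l in \<open>simp_all add: nth_monomial_basis n_def m_def d_def\<close>)
  also have "e \<dots> = det (mat n n (\<lambda>(i, j). e (D i (x ^ (d j div 2) * y ^ (d j mod 2)))))"
    by (intro e_det D_in_local_ring in_ring)
  also have "(\<lambda>(i, j). e (D i (x ^ (d j div 2) * y ^ (d j mod 2)))) =
      (\<lambda>(i, j). (taylor x ^ (d j div 2) * sum_var ^ (d j mod 2)) $ i)"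
    by (simp add: fun_eq_iff taylor_mult taylor_power taylor_y_power x_in_local_ring
        y_in_local_ring local_ring_power flip: taylor_nth)
  finally show ?thesis .
qed

text \<open>Both expansions are \<open>X^b\<close> times a series with constant term
  \<open>\<mu> (2c)^b c^(l(l - g))\<close>. For \<open>h\<close> this holds because
  \<open>D^1 x\<close> starts with \<open>2cX\<close> and \<open>D^2 x\<close> with
  \<open>c\<close>.\<close>

lemma lowest_order_terms:
  fixes l :: nat
  defines "w \<equiv> hasse_wronskian D (monomial_basis l g x y)"
    and "h \<equiv> \<iota> (of_int (det (M_matrix l g))) * D 1 x ^ ((g + 1) choose 2) * D 2 x ^ (l * (l - g))"
  assumes l: "g < l" and det_M: "(of_int (det (M_matrix l g)) :: 'a) \<noteq> 0"
  shows "e w \<noteq> 0" and "e h \<noteq> 0" and "lowest_order_term (e w) = lowest_order_term (e h)"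
proof -
  define m n d b where "m = l - g" and "n = 2 * m + (g + 1)" and "d = ramification_order m"
    and "b = (g + 1) choose 2"
  have l_eq: "l = m + g" using l by (simp add: m_def)
  obtain U where U: "taylor x - fps_const (fps_const \<gamma>) = sum_var\<^sup>2 * U" and U_nz: "U $ 0 $ 0 \<noteq> 0"
    using taylor_x by blast
  define c where "c = U $ 0 $ 0"
  define \<mu> :: 'k where "\<mu> = of_int (det (M_matrix l g))"
  have \<mu>: "\<kappa> (of_int (det (M_matrix l g))) = \<mu>" by (simp add: \<mu>_def residue.hom_of_int)
  have U_power: "(U ^ k) $ 0 $ 0 = c ^ k" for k
    by (simp add: c_def fps_power_zeroth)

  have column: "(taylor x - fps_const (fps_const \<gamma>)) ^ (d j div 2) * sum_var ^ (d j mod 2) =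
      sum_var ^ d j * U ^ (d j div 2)" for j
  proof -
    have "(sum_var\<^sup>2 * U) ^ (d j div 2) * sum_var ^ (d j mod 2) =
        sum_var ^ (2 * (d j div 2) + d j mod 2) * U ^ (d j div 2)"
      by (simp only: power_mult_distrib power_mult power_add mult_ac)
    then show ?thesis by (simp add: U)
  qed
  have "\<exists>G. fps_X ^ i * (sum_var ^ d j * U ^ (d j div 2)) $ i = fps_X ^ d j * G \<and>
      G $ 0 = of_nat (d j choose i) * c ^ (d j div 2)" for i j
    using nth_sum_var_power_mult[of i "d j" "U ^ (d j div 2)"] by (simp add: U_power)
  then obtain G where
    G: "\<And>i j. fps_X ^ i * (sum_var ^ d j * U ^ (d j div 2)) $ i = fps_X ^ d j * G i j" and
    G_0: "\<And>i j. G i j $ 0 = of_nat (d j choose i) * c ^ (d j div 2)"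
    by metis
  define W where "W = det (mat n n (\<lambda>(i, j). G i j))"
  have d_sum: "(\<Sum>j<n. d j) = (\<Sum>j<n. j) + b"
    unfolding n_def d_def b_def by (rule sum_ramification_order)
  have "e w = det (mat n n (\<lambda>(i, j). (taylor x ^ (d j div 2) * sum_var ^ (d j mod 2)) $ i))"
    unfolding w_def n_def d_def m_def using l by (rule e_hasse_wronskian_monomial_basis)
  \<comment> \<open>\<open>det_translate\<close>, read backwards, replaces \<open>x\<close> by
    \<open>x - \<gamma>\<close>, so that column \<open>j\<close> acquires the factor
    \<open>(X + z)^(d j)\<close>.\<close>
  also have "\<dots> = det (mat n n (\<lambda>(i, j). (sum_var ^ d j * U ^ (d j div 2)) $ i))"
    unfolding column[symmetric] unfolding d_def by (rule det_translate[symmetric])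
  also have "\<dots> = fps_X ^ b * W"
    unfolding W_def by (rule det_leading_term(1)[OF G d_sum])
  finally have w: "e w = fps_X ^ b * W" .

  have "W $ 0 = det (mat n n (\<lambda>(i, j). 1 * of_nat (d j choose i) * c ^ (d j div 2)))"
    unfolding W_def det_leading_term(2)[OF G d_sum] G_0 by simp
  also have "\<dots> = c ^ (\<Sum>j<n. d j div 2) * det (mat n n (\<lambda>(i, j). of_nat (d j choose i)))"
    by (subst det_scale) (simp add: power_sum)
  also have "mat n n (\<lambda>(i, j). of_nat (d j choose i)) =
      map_mat (of_int :: int \<Rightarrow> 'k) (mat n n (\<lambda>(i, j). int (d j choose i)))"
    by (rule eq_matI) auto
  also have "det \<dots> = 2 ^ b * \<mu>"
    unfolding of_int_hom.hom_det unfolding n_def d_def det_choose_ramification_order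
    by (simp add: b_def \<mu>_def l_eq)
  also have "(\<Sum>j<n. d j div 2) = b + l * (l - g)"
    unfolding n_def d_def sum_ramification_order_div_2 by (simp add: b_def l_eq)
  finally have W_0: "W $ 0 = \<mu> * (2 * c) ^ b * c ^ (l * (l - g))"
    by (simp add: power_add power_mult_distrib mult_ac)

  \<comment> \<open>Subtracting \<gamma> changes only the coefficient of \<open>z^0\<close>.\<close>
  have taylor_x_nth: "taylor x $ k = (sum_var\<^sup>2 * U) $ k" if "k > 0" for k
    using that by (simp flip: U)
  obtain G1 where "fps_X ^ 1 * (sum_var\<^sup>2 * U) $ 1 = fps_X\<^sup>2 * G1" and G1_0: "G1 $ 0 = 2 * c"
    using nth_sum_var_power_mult[of 1 2 U] by (auto simp: c_def)
  then have D1: "e (D 1 x) = fps_X * G1"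
    using taylor_x_nth[of 1] by (simp add: taylor_nth power2_eq_square mult.assoc)
  obtain G2 where "fps_X\<^sup>2 * (sum_var\<^sup>2 * U) $ 2 = fps_X\<^sup>2 * G2" and G2_0: "G2 $ 0 = c"
    using nth_sum_var_power_mult[of 2 2 U] by (auto simp: c_def)
  then have D2: "e (D 2 x) = G2"
    using taylor_x_nth[of 2] by (simp add: taylor_nth)
  define H where "H = fps_const \<mu> * G1 ^ b * G2 ^ (l * (l - g))"
  have "e h = fps_const \<mu> * e (D 1 x) ^ b * e (D 2 x) ^ (l * (l - g))"
    unfolding h_def b_def[symmetric]
    by (simp add: e_mult e_power e_const \<mu> D_in_local_ring x_in_local_ring const_in_local_ring
        local_ring_power local_ring_add_mult)
  then have h: "e h = fps_X ^ b * H"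
    unfolding D1 D2 H_def by (simp add: power_mult_distrib mult_ac)
  have H_0: "H $ 0 = W $ 0"
    by (simp add: H_def W_0 G1_0 G2_0 fps_power_zeroth)
  have "\<mu> \<noteq> 0"
    using det_M by (simp flip: \<mu>)
  \<comment> \<open>Here the characteristic matters: \<open>2c\<close> is nonzero.\<close>
  then have W_nz: "W $ 0 \<noteq> 0"
    using U_nz two_nonzero by (simp add: W_0 c_def)
  then have H_nz: "H $ 0 \<noteq> 0"
    by (simp only: H_0 not_False_eq_True)
  show "e w \<noteq> 0" "e h \<noteq> 0"
    unfolding w h by (fact lowest_order_term_fps_X_power_mult(1)[OF W_nz]
      lowest_order_term_fps_X_power_mult(1)[OF H_nz])+
  show "lowest_order_term (e w) = lowest_order_term (e h)"
    unfolding w h lowest_order_term_fps_X_power_mult(2)[OF W_nz]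
      lowest_order_term_fps_X_power_mult(2)[OF H_nz] H_0 ..
qed

end

theorem theorem3p5:
  fixes \<iota> :: "'a::field \<Rightarrow> 'L::field" and f :: "'a poly" and g l :: nat and x y :: 'L
    and \<kappa> :: "'a \<Rightarrow> 'k::field" and \<gamma> :: 'k
    and D :: "nat \<Rightarrow> 'L \<Rightarrow> 'L" and e :: "'L \<Rightarrow> 'k fps"
  assumes "affine_ramification_point \<iota> f g x y \<kappa> \<gamma>"
    and "affine_ramification_point.hasse_derivatives \<iota> x y \<kappa> \<gamma> D"
    and "affine_ramification_point.expansion \<iota> x y \<kappa> \<gamma> e"
    and "l > g"
    and "(of_int (det (M_matrix l g)) :: 'a) \<noteq> 0"
  shows "let w = hasse_wronskian D (monomial_basis l g x y);
             h = \<iota> (of_int (det (M_matrix l g))) *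
                 D 1 x ^ ((g + 1) choose 2) * D 2 x ^ (l * (l - g))
         in e w \<noteq> 0 \<and> e h \<noteq> 0 \<and> lowest_order_term (e w) = lowest_order_term (e h)"
proof -
  interpret hasse_expansion \<iota> f g x y \<kappa> \<gamma> D e
    using assms by (intro hasse_expansion.intro hasse_expansion_axioms.intro)
  show ?thesis
    using lowest_order_terms[OF assms(4,5)] by (simp add: Let_def)
qed

end
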